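(* Consider the Lagrangian system with Lagrangian $$L(x,\phi,\dot x,\dot\phi)=\frac12\big(x^2+1\big)\dot\phi^2+\frac12\dot x^2-x\sin\phi .$$ For any constants $\omega>0$ and $k\in\mathbb{N}$ this system has a solution $\phi(t),x(t)$, $t\in\mathbb{R}$, such that 1) $x(t)=-x(-t)$ and $\phi(t)=-\phi(-t)$ for all $t\in\mathbb{R}$; 2) $x(t+\omega)=x(t)$ and $\phi(t+\omega)=\phi(t)+2\pi k$ for all $t\in\mathbb{R}$.
   Context: A solution of the Lagrangian system means a pair of $C^2$ functions $x,\phi:\mathbb{R}\to\mathbb{R}$ satisfying on all of $\mathbb{R}$ the Lagrange equations $\frac{d}{dt}\frac{\partial L}{\partial\dot x}=\frac{\partial L}{\partial x}$ and $\frac{d}{dt}\frac{\partial L}{\partial\dot\phi}=\frac{\partial L}{\partial\phi}$, i.e. $$\ddot x=x\dot\phi^2-\sin\phi,\qquad \frac{d}{dt}\big((1+x^2)\dot\phi\big)=-x\cos\phi .$$ Here $\mathbb{N}=\{1,2,3,\dots\}$. (The variable $\phi$ is an angle, lifted to $\mathbb{R}$; $x$ is a real coordinate.) *)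

theory Defs
  imports "HOL-Analysis.Analysis"
begin

definition C2_on_reals :: "(real \<Rightarrow> real) \<Rightarrow> bool" where
  "C2_on_reals f \<longleftrightarrow>
     f C1_differentiable_on UNIV \<and> deriv f C1_differentiable_on UNIV"

text \<open>
  A Lagrangian with two degrees of freedom takes its arguments in the order
  \<open>L q\<^sub>1 q\<^sub>2 v\<^sub>1 v\<^sub>2\<close> (positions, then velocities).  The positions and the velocities
  are independent variables when the partial derivatives are formed, and only then is the
  curve inserted.  Since \<^const>\<open>deriv\<close> is unspecified at points of non-differentiability,
  these equations are meaningful for differentiable \<open>L\<close> only.
\<close>

definition lagrange_equations ::
    "(real \<Rightarrow> real \<Rightarrow> real \<Rightarrow> real \<Rightarrow> real) \<Rightarrow> (real \<Rightarrow> real) \<Rightarrow> (real \<Rightarrow> real) \<Rightarrow> bool" where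
  "lagrange_equations L q\<^sub>1 q\<^sub>2 \<longleftrightarrow>
     (\<forall>t.
       ((\<lambda>s. deriv (\<lambda>v. L (q\<^sub>1 s) (q\<^sub>2 s) v (deriv q\<^sub>2 s)) (deriv q\<^sub>1 s))
          has_real_derivative
            deriv (\<lambda>q. L q (q\<^sub>2 t) (deriv q\<^sub>1 t) (deriv q\<^sub>2 t)) (q\<^sub>1 t)) (at t) \<and>
       ((\<lambda>s. deriv (\<lambda>v. L (q\<^sub>1 s) (q\<^sub>2 s) (deriv q\<^sub>1 s) v) (deriv q\<^sub>2 s))
          has_real_derivative
            deriv (\<lambda>q. L (q\<^sub>1 t) q (deriv q\<^sub>1 t) (deriv q\<^sub>2 t)) (q\<^sub>2 t)) (at t))"

definition lagrangian_solution ::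
    "(real \<Rightarrow> real \<Rightarrow> real \<Rightarrow> real \<Rightarrow> real) \<Rightarrow> (real \<Rightarrow> real) \<Rightarrow> (real \<Rightarrow> real) \<Rightarrow> bool" where
  "lagrangian_solution L q\<^sub>1 q\<^sub>2 \<longleftrightarrow>
     C2_on_reals q\<^sub>1 \<and> C2_on_reals q\<^sub>2 \<and> lagrange_equations L q\<^sub>1 q\<^sub>2"

definition Lagr :: "real \<Rightarrow> real \<Rightarrow> real \<Rightarrow> real \<Rightarrow> real" where
  "Lagr x \<phi> x' \<phi>' = 1 / 2 * (x\<^sup>2 + 1) * \<phi>'\<^sup>2 + 1 / 2 * x'\<^sup>2 - x * sin \<phi>"

end

theory Submission
  imports Defs
begin

text \<open>
  With \<open>T = \<omega> / 2\<close> it suffices to solve the boundary value problem \<open>x(0) = x(T) = 0\<close>,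
  \<open>\<phi>(0) = 0\<close>, \<open>\<phi>(T) = \<pi> k\<close>: the equations are invariant under the reflections
  \<open>(x, \<phi>)(t) \<mapsto> - (x, \<phi>)(-t)\<close> and \<open>(x, \<phi>)(t) \<mapsto> (0, 2 \<pi> k) - (x, \<phi>)(2 T - t)\<close>, so by
  uniqueness the solution is invariant too, which gives oddness and periodicity.

  For the boundary value problem, truncate \<open>x\<close> and the momenta \<open>u = x'\<close>, \<open>p = (1 + x\<^sup>2) \<phi>'\<close> in
  the first order equations. The truncated field is bounded and Lipschitz, so it has a continuous
  global flow. The momenta on \<open>[0, T]\<close> then differ from their initial values by bounded amounts;
  hence \<open>x(T)\<close> and \<open>\<phi>(T) - \<pi> k\<close> change sign between opposite sides of a large rectangle of
  initial momenta, and have a common zero by Poincare--Miranda. Since \<open>x'' \<ge> -1\<close> where \<open>x > 0\<close> and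
  \<open>x'' \<le> 1\<close> where \<open>x < 0\<close>, the boundary values force \<open>\<bar>x\<bar> \<le> T\<^sup>2 / 4\<close>, and the truncation is
  inactive.
\<close>

section \<open>Flows of bounded Lipschitz vector fields\<close>

text \<open>The primitive vanishing at \<open>0\<close>, scaled to a fixed interval of integration so that negative
  times need no separate treatment.\<close>

definition primitive :: "(real \<Rightarrow> 'a::banach) \<Rightarrow> real \<Rightarrow> 'a" where
  "primitive g t = t *\<^sub>R integral {0..1} (\<lambda>s. g (t * s))"

lemma continuous_on_rescale:
  fixes g :: "real \<Rightarrow> 'a::topological_space"
  assumes "continuous_on UNIV g"
  shows "continuous_on S (\<lambda>s. g (t * s))"
  by (rule continuous_on_compose2[OF assms]) (auto intro!: continuous_intros)

lemma primitive_0 [simp]: "primitive g 0 = 0"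
  by (simp add: primitive_def)

lemma primitive_diff:
  assumes "continuous_on UNIV g" "continuous_on UNIV h"
  shows "primitive (\<lambda>s. g s - h s) t = primitive g t - primitive h t"
  unfolding primitive_def
  by (subst integral_diff)
    (auto intro!: integrable_continuous_real continuous_on_rescale assms simp: scaleR_diff_right)

text \<open>On an interval \<open>{-N..N}\<close> with \<open>t\<close> in its interior,
  \<open>g\<close> has an antiderivative \<open>G\<close>. The substitution \<open>u * s\<close> and
  the fundamental theorem turn \<open>primitive g u\<close> into \<open>G u - G 0\<close> for every
  \<open>u\<close> near \<open>t\<close>, and differentiability is local.\<close>

lemma primitive_has_vector_derivative:
  fixes g :: "real \<Rightarrow> 'a::banach"
  assumes g: "continuous_on UNIV g"
  shows "(primitive g has_vector_derivative g t) (at t)"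
proof -
  define N where "N = \<bar>t\<bar> + 1"
  obtain G where G: "\<And>x. x \<in> {-N..N} \<Longrightarrow> (G has_vector_derivative g x) (at x within {-N..N})"
    using antiderivative_continuous continuous_on_subset[OF g subset_UNIV] by metis
  have t: "t \<in> {-N<..<N}" by (auto simp: N_def)
  have *: "primitive g u = G u - G 0" if u: "u \<in> {-N<..<N}" for u
  proof -
    have us: "u * s \<in> {-N..N}" if "s \<in> {0..1}" for s
    proof -
      have "\<bar>u * s\<bar> \<le> \<bar>u\<bar>" using that by (simp add: abs_mult mult_left_le)
      then show ?thesis using u by auto
    qed
    have "((\<lambda>s. u *\<^sub>R g (u * s)) has_integral G (u * 1) - G (u * 0)) {0..1}"
    proof (rule fundamental_theorem_of_calculus)
      fix s :: real assume s: "s \<in> {0..1}"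
      have "((G \<circ> (\<lambda>s. u * s)) has_vector_derivative u *\<^sub>R g (u * s)) (at s within {0..1})"
      proof (rule vector_diff_chain_within)
        show "((*) u has_vector_derivative u) (at s within {0..1})"
          by (auto intro!: derivative_eq_intros)
        show "(G has_vector_derivative g (u * s)) (at (u * s) within (*) u ` {0..1})"
          by (rule has_vector_derivative_within_subset[OF G]) (use us s in auto)
      qed
      then show "((\<lambda>s. G (u * s)) has_vector_derivative u *\<^sub>R g (u * s)) (at s within {0..1})"
        by (simp add: o_def)
    qed simp
    from integral_unique[OF this] show ?thesis by (simp add: primitive_def)
  qed
  have "(G has_vector_derivative g t) (at t)"
    using G[of t] t by (metis at_within_Icc_at greaterThanLessThan_iff greaterThanLessThan_subseteq_atLeastAtMost_iff order_refl subsetD)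
  then have "((\<lambda>u. G u - G 0) has_vector_derivative g t) (at t)"
    by (auto intro!: derivative_eq_intros)
  then show ?thesis
    by (rule has_vector_derivative_transform_within_open[where S = "{-N<..<N}"]) (use t * in auto)
qed

text \<open>Integrating \<open>exp (K * s)\<close> gains a factor \<open>1 / K\<close>. This gain,
  uniform in time, makes the Picard operator contract in the weighted norm.\<close>

lemma norm_primitive_le:
  assumes g: "continuous_on UNIV g" and K: "K > 0"
    and le: "\<And>s. norm (g s) \<le> C * exp (K * \<bar>s\<bar>)"
  shows "norm (primitive g t) \<le> C / K * exp (K * \<bar>t\<bar>)"
proof -
  have C: "C \<ge> 0" using le[of 0] norm_ge_zero[of "g 0"] by (simp del: norm_ge_zero)
  have "((\<lambda>s. \<bar>t\<bar> * (C * exp (K * \<bar>t\<bar> * s))) has_integral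
          C / K * exp (K * \<bar>t\<bar> * 1) - C / K * exp (K * \<bar>t\<bar> * 0)) {0..1}"
    by (rule fundamental_theorem_of_calculus)
      (use K in \<open>auto intro!: derivative_eq_intros
        simp flip: has_real_derivative_iff_has_vector_derivative\<close>)
  then have I: "((\<lambda>s. \<bar>t\<bar> * (C * exp (K * \<bar>t\<bar> * s))) has_integral
          C / K * exp (K * \<bar>t\<bar>) - C / K) {0..1}" by simp
  have "norm (integral {0..1} (\<lambda>s. t *\<^sub>R g (t * s)))
      \<le> integral {0..1} (\<lambda>s. \<bar>t\<bar> * (C * exp (K * \<bar>t\<bar> * s)))"
  proof (rule integral_norm_bound_integral)
    show "(\<lambda>s. t *\<^sub>R g (t * s)) integrable_on {0..1}"
      by (intro integrable_continuous_real continuous_intros continuous_on_rescale g)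
    show "(\<lambda>s. \<bar>t\<bar> * (C * exp (K * \<bar>t\<bar> * s))) integrable_on {0..1}"
      using I by blast
    fix s :: real assume "s \<in> {0..1}"
    then show "norm (t *\<^sub>R g (t * s)) \<le> \<bar>t\<bar> * (C * exp (K * \<bar>t\<bar> * s))"
      using mult_left_mono[OF le[of "t * s"], of "\<bar>t\<bar>"] by (simp add: abs_mult mult.assoc)
  qed
  also have "\<dots> = C / K * exp (K * \<bar>t\<bar>) - C / K" using I by (rule integral_unique)
  also have "\<dots> \<le> C / K * exp (K * \<bar>t\<bar>)" using C K by simp
  finally show ?thesis by (simp add: primitive_def)
qed

text \<open>Since the interval of integration is fixed, the time is just one more parameter of the
  integrand.\<close>

lemma continuous_on_primitive_param:
  fixes g :: "'p::topological_space \<Rightarrow> real \<Rightarrow> 'a::banach"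
  assumes g: "continuous_on UNIV (\<lambda>(r, t). g r t)"
  shows "continuous_on UNIV (\<lambda>(r, t). primitive (g r) t)"
proof -
  have "continuous_on (UNIV \<times> cbox 0 1) (\<lambda>(q, s). g (fst q) (snd q * s))"
    unfolding case_prod_unfold
    by (rule continuous_on_compose2[OF g[unfolded case_prod_unfold],
          of _ "\<lambda>x. (fst (fst x), snd (fst x) * snd x)", simplified])
      (intro continuous_intros)
  from integral_continuous_on_param[OF this]
  have "continuous_on UNIV (\<lambda>q. integral {0..1} (\<lambda>s. g (fst q) (snd q * s)))" by simp
  then show ?thesis
    unfolding primitive_def case_prod_unfold by (intro continuous_intros)
qed

text \<open>The unknown of the fixed point equation is \<open>exp (- K \<bar>t\<bar>) (Z r t - r)\<close>, as a function of the
  initial value and the time jointly: the weight makes the Picard operator a contraction for all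
  times at once, and continuous dependence on the initial value comes for free.\<close>

lemma lipschitz_bounded_flow:
  fixes f :: "'a::banach \<Rightarrow> 'a"
  assumes lip: "L-lipschitz_on UNIV f" and B: "\<And>x. norm (f x) \<le> B"
  obtains Z where "continuous_on UNIV (\<lambda>(r, t). Z r t)" "\<And>r. Z r 0 = r"
    "\<And>r t. (Z r has_vector_derivative f (Z r t)) (at t)"
proof -
  \<comment> \<open>The contraction factor will be \<open>L / K\<close>, so \<open>K\<close> has to
    exceed \<open>L\<close>; the summand 1 keeps it positive when \<open>L = 0\<close>.\<close>
  define K where "K = 2 * L + 1"
  have L: "L \<ge> 0" using lip by (rule lipschitz_on_nonneg)
  then have K: "K > 0" by (simp add: K_def)
  have contf: "continuous_on UNIV f" using lip by (rule lipschitz_on_continuous_on)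
  \<comment> \<open>The field along the curve encoded by \<open>y\<close>: multiplying by
    \<open>exp (K * \<bar>s\<bar>)\<close> removes the weight and adding \<open>r\<close> restores
    the initial value.\<close>
  define rhs where "rhs y r s = f (r + exp (K * \<bar>s\<bar>) *\<^sub>R apply_bcontfun y (r, s))" for y r s
  define \<Phi> where "\<Phi> y = (\<lambda>(r, t). exp (- K * \<bar>t\<bar>) *\<^sub>R primitive (rhs y r) t)" for y
  have cont2: "continuous_on UNIV (\<lambda>(r, s). rhs y r s)" for y
    unfolding rhs_def case_prod_unfold
    by (intro continuous_on_compose2[OF contf] continuous_intros
        continuous_on_compose2[OF continuous_on_apply_bcontfun]) auto
  have cont1: "continuous_on UNIV (rhs y r)" for y r
    by (rule continuous_on_compose2[OF cont2, of UNIV "\<lambda>s. (r, s)" y, simplified])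
      (intro continuous_intros)
  have bc: "\<Phi> y \<in> bcontfun" for y
  proof (rule bcontfun_normI)
    show "continuous_on UNIV (\<Phi> y)"
      using continuous_on_primitive_param[OF cont2, of y] unfolding \<Phi>_def case_prod_unfold
      by (intro continuous_intros)
    fix q :: "'a \<times> real"
    obtain r t where q: "q = (r, t)" by force
    have B0: "B \<ge> 0" using B[of 0] norm_ge_zero order_trans by blast
    have "norm (rhs y r s) \<le> B * exp (K * \<bar>s\<bar>)" for s
    proof -
      have "norm (rhs y r s) \<le> B * 1" by (simp add: rhs_def B)
      also have "\<dots> \<le> B * exp (K * \<bar>s\<bar>)" using B0 K by (intro mult_left_mono) auto
      finally show ?thesis .
    qed
    \<comment> \<open>The weight cancels the exponential in the bound of the primitive, leaving a
      constant.\<close>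
    from mult_left_mono[OF norm_primitive_le[OF cont1 K this, of t], of "exp (- K * \<bar>t\<bar>)"]
    show "norm (\<Phi> y q) \<le> B / K" by (simp add: \<Phi>_def q exp_minus divide_simps)
  qed
  have app: "apply_bcontfun (Bcontfun (\<Phi> y)) = \<Phi> y" for y
    using bc by (rule Bcontfun_inverse)
  have "\<exists>!y. Bcontfun (\<Phi> y) = y"
  proof (rule banach_fix_type)
    show "0 \<le> L / K" "L / K < 1" using L K by (auto simp: K_def)
    show "\<forall>y y'. dist (Bcontfun (\<Phi> y)) (Bcontfun (\<Phi> y')) \<le> L / K * dist y y'"
    proof (intro allI dist_bound)
      fix y y' :: "('a \<times> real) \<Rightarrow>\<^sub>C 'a" and q :: "'a \<times> real"
      obtain r t where q: "q = (r, t)" by force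
      have "norm (rhs y r s - rhs y' r s) \<le> L * dist y y' * exp (K * \<bar>s\<bar>)" for s
      proof -
        have "norm (rhs y r s - rhs y' r s) \<le>
            L * norm (exp (K * \<bar>s\<bar>) *\<^sub>R (y (r, s) - y' (r, s)))"
          using lipschitz_on_normD[OF lip, of "r + exp (K * \<bar>s\<bar>) *\<^sub>R y (r, s)"
              "r + exp (K * \<bar>s\<bar>) *\<^sub>R y' (r, s)"]
          by (simp add: rhs_def algebra_simps)
        also have "\<dots> = L * exp (K * \<bar>s\<bar>) * dist (y (r, s)) (y' (r, s))"
          by (simp add: dist_norm)
        also have "\<dots> \<le> L * exp (K * \<bar>s\<bar>) * dist y y'"
          using L by (intro mult_left_mono dist_bounded) auto
        finally show ?thesis by (simp add: mult_ac)
      qed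
      from norm_primitive_le[OF continuous_on_diff[OF cont1 cont1] K this, of t]
      have "norm (primitive (rhs y r) t - primitive (rhs y' r) t)
          \<le> L * dist y y' / K * exp (K * \<bar>t\<bar>)"
        by (simp add: primitive_diff cont1)
      from mult_left_mono[OF this, of "exp (- K * \<bar>t\<bar>)"]
      show "dist (Bcontfun (\<Phi> y) q) (Bcontfun (\<Phi> y') q) \<le> L / K * dist y y'"
        unfolding app
        by (simp add: \<Phi>_def q dist_norm exp_minus divide_simps flip: scaleR_diff_right)
    qed
  qed
  then obtain y where y: "Bcontfun (\<Phi> y) = y" by blast
  define Z where "Z r t = r + primitive (rhs y r) t" for r t
  have "exp (K * \<bar>t\<bar>) *\<^sub>R y (r, t) = primitive (rhs y r) t" for r t
  proof -
    have "y (r, t) = exp (- K * \<bar>t\<bar>) *\<^sub>R primitive (rhs y r) t"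
      using fun_cong[OF app[of y], of "(r, t)"] unfolding y by (simp add: \<Phi>_def)
    then show ?thesis by (simp add: exp_minus)
  qed
  then have rhsZ: "rhs y r t = f (Z r t)" for r t by (simp add: rhs_def Z_def)
  show thesis
  proof
    show "continuous_on UNIV (\<lambda>(r, t). Z r t)"
      using continuous_on_primitive_param[OF cont2, of y] unfolding Z_def case_prod_unfold
      by (intro continuous_intros)
    show "Z r 0 = r" for r by (simp add: Z_def)
    show "(Z r has_vector_derivative f (Z r t)) (at t)" for r t
      using primitive_has_vector_derivative[OF cont1, of y r t] unfolding Z_def[abs_def]
      by (auto intro!: derivative_eq_intros simp: rhsZ[unfolded Z_def])
  qed
qed

text \<open>Gronwall in differential form: by Cauchy-Schwarz the squared distance of two solutions
  grows at rate at most \<open>2 * L\<close>, so after division by \<open>exp (2 * L * s)\<close> it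
  is nonincreasing, and it starts at 0.\<close>

lemma lipschitz_ode_unique_forward:
  fixes f :: "'a::real_inner \<Rightarrow> 'a"
  assumes lip: "L-lipschitz_on UNIV f"
    and z: "\<And>t. (z has_vector_derivative f (z t)) (at t)"
    and w: "\<And>t. (w has_vector_derivative f (w t)) (at t)"
    and eq: "z t0 = w t0" and "t0 \<le> t"
  shows "z t = w t"
proof -
  define h where "h s = exp (- 2 * L * s) * ((z s - w s) \<bullet> (z s - w s))" for s
  have "h t \<le> h t0"
  proof (rule DERIV_nonpos_imp_nonincreasing[OF \<open>t0 \<le> t\<close>])
    fix s
    have d: "((\<lambda>s. z s - w s) has_derivative (\<lambda>h. h *\<^sub>R (f (z s) - f (w s)))) (at s)"
      using has_vector_derivative_diff[OF z w, of s] by (simp add: has_vector_derivative_def)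
    have "((\<lambda>s. (z s - w s) \<bullet> (z s - w s)) has_derivative
        (\<lambda>h. h * (2 * ((z s - w s) \<bullet> (f (z s) - f (w s)))))) (at s)"
      by (rule has_derivative_eq_rhs[OF has_derivative_inner[OF d d]])
        (auto simp: inner_commute algebra_simps)
    then have d2: "((\<lambda>s. (z s - w s) \<bullet> (z s - w s)) has_real_derivative
        2 * ((z s - w s) \<bullet> (f (z s) - f (w s)))) (at s)"
      by (simp add: has_field_derivative_def mult_commute_abs)
    have "((\<lambda>s. exp (- 2 * L * s)) has_real_derivative - 2 * L * exp (- 2 * L * s)) (at s)"
      by (auto intro!: derivative_eq_intros)
    from DERIV_mult[OF this d2]
    have "(h has_real_derivative exp (- 2 * L * s) * (2 * ((z s - w s) \<bullet> (f (z s) - f (w s))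
        - L * ((z s - w s) \<bullet> (z s - w s))))) (at s)"
      unfolding h_def[abs_def] by (rule DERIV_cong) (simp only: algebra_simps)
    moreover have "(z s - w s) \<bullet> (f (z s) - f (w s)) \<le> L * ((z s - w s) \<bullet> (z s - w s))"
    proof -
      have "(z s - w s) \<bullet> (f (z s) - f (w s)) \<le> norm (z s - w s) * norm (f (z s) - f (w s))"
        by (rule norm_cauchy_schwarz)
      also have "\<dots> \<le> norm (z s - w s) * (L * norm (z s - w s))"
        using lipschitz_on_normD[OF lip] by (intro mult_left_mono) auto
      finally show ?thesis by (simp add: dot_square_norm power2_eq_square mult_ac)
    qed
    ultimately show "\<exists>y. (h has_real_derivative y) (at s) \<and> y \<le> 0"
      by (intro exI conjI) (auto intro!: mult_nonneg_nonpos simp del: inner_diff)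
  qed
  also have "h t0 = 0" by (simp add: h_def eq)
  finally have "(z t - w t) \<bullet> (z t - w t) \<le> 0"
    by (simp add: h_def mult_le_0_iff not_le[symmetric])
  then show ?thesis by (metis eq_iff_diff_eq_0 inner_eq_zero_iff inner_ge_zero order_antisym)
qed

text \<open>Times before \<open>t0\<close> reduce to later ones by reversing time, which replaces
  \<open>f\<close> by its negative.\<close>

lemma lipschitz_ode_unique:
  fixes f :: "'a::real_inner \<Rightarrow> 'a"
  assumes lip: "L-lipschitz_on UNIV f"
    and z: "\<And>t. (z has_vector_derivative f (z t)) (at t)"
    and w: "\<And>t. (w has_vector_derivative f (w t)) (at t)"
    and eq: "z t0 = w t0"
  shows "z t = w t"
proof (cases "t0 \<le> t")
  case True
  then show ?thesis using lipschitz_ode_unique_forward[OF lip z w eq] by simp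
next
  case False
  have rev: "((\<lambda>t. v (- t)) has_vector_derivative - f (v (- t))) (at t)"
    if "\<And>t. (v has_vector_derivative f (v t)) (at t)" for v t
  proof -
    have "(uminus has_vector_derivative - 1) (at t)" by (auto intro!: derivative_eq_intros)
    from vector_diff_chain_at[OF this that] show ?thesis by (simp add: o_def)
  qed
  have "z (- (- t)) = w (- (- t))"
    by (rule lipschitz_ode_unique_forward[of L "\<lambda>x. - f x" "\<lambda>t. z (- t)" "\<lambda>t. w (- t)" "- t0"])
      (use False in \<open>auto intro!: rev z w lip simp: eq\<close>)
  then show ?thesis by simp
qed

section \<open>Bounded Lipschitz functions\<close>

text \<open>The two bounds are kept together because a product of Lipschitz functions is in general
  Lipschitz only if the factors are bounded.\<close>

definition bounded_lipschitz :: "('a::metric_space \<Rightarrow> 'b::real_normed_vector) \<Rightarrow> bool" where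
  "bounded_lipschitz f \<longleftrightarrow> (\<exists>L. L-lipschitz_on UNIV f) \<and> (\<exists>B. \<forall>x. norm (f x) \<le> B)"

lemma bounded_lipschitzE:
  assumes "bounded_lipschitz f"
  obtains L B where "L-lipschitz_on UNIV f" "L \<ge> 0" "\<And>x. norm (f x) \<le> B" "B \<ge> 0"
proof -
  obtain L B where LB: "L-lipschitz_on UNIV f" "\<And>x. norm (f x) \<le> B"
    using assms unfolding bounded_lipschitz_def by blast
  moreover have "B \<ge> 0" using LB(2) norm_ge_zero order_trans by blast
  ultimately show thesis using that lipschitz_on_nonneg by blast
qed

lemma bounded_lipschitz_uminus:
  "bounded_lipschitz f \<Longrightarrow> bounded_lipschitz (\<lambda>x. - f x)"
  by (auto simp: bounded_lipschitz_def)

lemma bounded_lipschitz_add: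
  assumes "bounded_lipschitz f" "bounded_lipschitz g"
  shows "bounded_lipschitz (\<lambda>x. f x + g x)"
proof -
  obtain L B where f: "L-lipschitz_on UNIV f" "\<And>x. norm (f x) \<le> B"
    using assms(1) by (metis bounded_lipschitzE)
  obtain M C where g: "M-lipschitz_on UNIV g" "\<And>x. norm (g x) \<le> C"
    using assms(2) by (metis bounded_lipschitzE)
  have "norm (f x + g x) \<le> B + C" for x using f(2) g(2) by (rule norm_add_rule_thm)
  then show ?thesis
    using lipschitz_on_add[OF f(1) g(1)] unfolding bounded_lipschitz_def by blast
qed

lemma bounded_lipschitz_diff:
  "bounded_lipschitz f \<Longrightarrow> bounded_lipschitz g \<Longrightarrow> bounded_lipschitz (\<lambda>x. f x - g x)"
  using bounded_lipschitz_add[of f "\<lambda>x. - g x"] bounded_lipschitz_uminus[of g] by simp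

lemma bounded_lipschitz_Pair:
  assumes "bounded_lipschitz f" "bounded_lipschitz g"
  shows "bounded_lipschitz (\<lambda>x. (f x, g x))"
proof -
  obtain L B where f: "L-lipschitz_on UNIV f" "\<And>x. norm (f x) \<le> B"
    using assms(1) by (metis bounded_lipschitzE)
  obtain M C where g: "M-lipschitz_on UNIV g" "\<And>x. norm (g x) \<le> C"
    using assms(2) by (metis bounded_lipschitzE)
  have "norm (f x, g x) \<le> B + C" for x
    using norm_Pair_le[of "f x" "g x"] f(2)[of x] g(2)[of x] by linarith
  with lipschitz_on_Pair[OF f(1) g(1)] show ?thesis unfolding bounded_lipschitz_def by blast
qed

lemma bounded_lipschitz_mult:
  fixes f g :: "'a::metric_space \<Rightarrow> real"
  assumes "bounded_lipschitz f" "bounded_lipschitz g"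
  shows "bounded_lipschitz (\<lambda>x. f x * g x)"
proof -
  obtain L B where f: "L-lipschitz_on UNIV f" "L \<ge> 0" "\<And>x. norm (f x) \<le> B" "B \<ge> 0"
    using assms(1) by (metis bounded_lipschitzE)
  obtain M C where g: "M-lipschitz_on UNIV g" "M \<ge> 0" "\<And>x. norm (g x) \<le> C" "C \<ge> 0"
    using assms(2) by (metis bounded_lipschitzE)
  have "(B * M + L * C)-lipschitz_on UNIV (\<lambda>x. f x * g x)"
  proof (rule lipschitz_onI)
    fix x y
    have "\<bar>f x * g x - f y * g y\<bar> = \<bar>f x * (g x - g y) + (f x - f y) * g y\<bar>"
      by (simp add: algebra_simps)
    also have "\<dots> \<le> \<bar>f x\<bar> * \<bar>g x - g y\<bar> + \<bar>f x - f y\<bar> * \<bar>g y\<bar>"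
      unfolding abs_mult[symmetric] by (rule abs_triangle_ineq)
    also have "\<dots> \<le> B * (M * dist x y) + (L * dist x y) * C"
      using f g lipschitz_onD[OF f(1), of x y] lipschitz_onD[OF g(1), of x y]
      by (intro add_mono mult_mono) (auto simp: dist_real_def)
    finally show "dist (f x * g x) (f y * g y) \<le> (B * M + L * C) * dist x y"
      by (simp add: dist_real_def algebra_simps)
  qed (use f g in simp)
  moreover have "norm (f x * g x) \<le> B * C" for x
    unfolding norm_mult using f g by (intro mult_mono) auto
  ultimately show ?thesis unfolding bounded_lipschitz_def by blast
qed

lemma bounded_lipschitz_inverse:
  fixes f :: "'a::metric_space \<Rightarrow> real"
  assumes "bounded_lipschitz f" and ge: "\<And>x. f x \<ge> 1"
  shows "bounded_lipschitz (\<lambda>x. 1 / f x)"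
proof -
  obtain L where f: "L-lipschitz_on UNIV f" "L \<ge> 0"
    using assms(1) by (metis bounded_lipschitzE)
  have "L-lipschitz_on UNIV (\<lambda>x. 1 / f x)"
  proof (rule lipschitz_onI)
    fix x y
    have pos: "f x > 0" "f y > 0" using ge[of x] ge[of y] by linarith+
    have "1 \<le> f x * f y" using mult_mono[OF ge[of x] ge[of y]] pos by simp
    then have "\<bar>f x - f y\<bar> / (f x * f y) \<le> \<bar>f x - f y\<bar> / 1"
      using pos by (intro divide_left_mono) auto
    moreover have "1 / f x - 1 / f y = (f y - f x) / (f x * f y)"
      using pos by (subst diff_frac_eq) auto
    ultimately have "\<bar>1 / f x - 1 / f y\<bar> \<le> \<bar>f x - f y\<bar>"
      using pos by (simp add: abs_mult abs_minus_commute)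
    also have "\<dots> \<le> L * dist x y" using lipschitz_onD[OF f(1), of x y] by (simp add: dist_real_def)
    finally show "dist (1 / f x) (1 / f y) \<le> L * dist x y" by (simp add: dist_real_def)
  qed (rule f)
  moreover have "norm (1 / f x) \<le> 1" for x using ge[of x] by (simp add: divide_simps)
  ultimately show ?thesis unfolding bounded_lipschitz_def by blast
qed

lemma bounded_lipschitz_const: "bounded_lipschitz (\<lambda>x. c)"
  unfolding bounded_lipschitz_def using lipschitz_on_constant by blast

text \<open>The inner function may be unbounded: it will be a coordinate projection of the phase
  space.\<close>

lemma bounded_lipschitz_compose:
  assumes "bounded_lipschitz g" and f: "1-lipschitz_on UNIV f"
  shows "bounded_lipschitz (\<lambda>x. g (f x))"
proof -
  obtain L B where g: "L-lipschitz_on UNIV g" "\<And>x. norm (g x) \<le> B"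
    using assms(1) by (metis bounded_lipschitzE)
  have "(L * 1)-lipschitz_on UNIV (\<lambda>x. g (f x))"
    by (rule lipschitz_on_compose2[OF f lipschitz_on_subset[OF g(1) subset_UNIV]])
  then show ?thesis unfolding bounded_lipschitz_def using g(2) by blast
qed

lemma bounded_lipschitz_sin: "bounded_lipschitz (sin :: real \<Rightarrow> real)"
  and bounded_lipschitz_cos: "bounded_lipschitz (cos :: real \<Rightarrow> real)"
proof -
  have "\<bar>sin x - sin y\<bar> \<le> 1 * \<bar>x - y\<bar>" for x y :: real
    using field_differentiable_bound[of UNIV sin cos 1 x y]
    by (auto simp: DERIV_sin intro: has_field_derivative_at_within)
  moreover have "\<bar>cos x - cos y\<bar> \<le> 1 * \<bar>x - y\<bar>" for x y :: real
    using field_differentiable_bound[of UNIV cos "\<lambda>x. - sin x" 1 x y]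
    by (auto simp: DERIV_cos intro: has_field_derivative_at_within)
  ultimately have "1-lipschitz_on UNIV (sin :: real \<Rightarrow> real)" "1-lipschitz_on UNIV (cos :: real \<Rightarrow> real)"
    by (auto intro!: lipschitz_onI simp: dist_real_def)
  then show "bounded_lipschitz (sin :: real \<Rightarrow> real)" "bounded_lipschitz (cos :: real \<Rightarrow> real)"
    unfolding bounded_lipschitz_def real_norm_def using abs_sin_le_one abs_cos_le_one by blast+
qed

definition clip :: "real \<Rightarrow> real \<Rightarrow> real" where
  "clip M x = max (- M) (min M x)"

lemma clip_id: "\<bar>x\<bar> \<le> M \<Longrightarrow> clip M x = x"
  by (auto simp: clip_def)

lemma abs_clip_le: "M \<ge> 0 \<Longrightarrow> \<bar>clip M x\<bar> \<le> M"
  by (auto simp: clip_def)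

lemma clip_minus [simp]: "M \<ge> 0 \<Longrightarrow> clip M (- x) = - clip M x"
  by (auto simp: clip_def)

lemma clip_nonneg: "M \<ge> 0 \<Longrightarrow> x \<ge> 0 \<Longrightarrow> clip M x \<ge> 0"
  by (auto simp: clip_def)

lemma clip_nonpos: "M \<ge> 0 \<Longrightarrow> x \<le> 0 \<Longrightarrow> clip M x \<le> 0"
  by (auto simp: clip_def)

lemma bounded_lipschitz_clip: "bounded_lipschitz (clip M)" if "M \<ge> 0"
proof -
  have "1-lipschitz_on UNIV (clip M)"
    by (auto intro!: lipschitz_onI simp: dist_real_def clip_def)
  then show ?thesis unfolding bounded_lipschitz_def real_norm_def using abs_clip_le[OF that] by blast
qed

section \<open>A two-dimensional intermediate value theorem\<close>

text \<open>Brouwer's theorem is applied to \<open>v - (g v, h v)\<close> pushed back into the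
  rectangle by clipping. The sign conditions on the sides exclude fixed points at which the clipping
  hides a nonzero value.\<close>

lemma poincare_miranda_2:
  fixes g h :: "real \<times> real \<Rightarrow> real"
  assumes AC: "A \<ge> 0" "C \<ge> 0" and cont: "continuous_on UNIV g" "continuous_on UNIV h"
    and g: "\<And>c. \<bar>c\<bar> \<le> C \<Longrightarrow> g (- A, c) \<le> 0" "\<And>c. \<bar>c\<bar> \<le> C \<Longrightarrow> g (A, c) \<ge> 0"
    and h: "\<And>a. \<bar>a\<bar> \<le> A \<Longrightarrow> h (a, - C) \<le> 0" "\<And>a. \<bar>a\<bar> \<le> A \<Longrightarrow> h (a, C) \<ge> 0"
  obtains a c where "\<bar>a\<bar> \<le> A" "\<bar>c\<bar> \<le> C" "g (a, c) = 0" "h (a, c) = 0"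
proof -
  define F where "F v = (clip A (fst v - g v), clip C (snd v - h v))" for v
  have "continuous_on ({-A..A} \<times> {-C..C}) F"
    unfolding F_def clip_def
    by (intro continuous_intros continuous_on_subset[OF cont(1)] continuous_on_subset[OF cont(2)]) auto
  moreover have "F v \<in> {-A..A} \<times> {-C..C}" for v
    using abs_clip_le[OF AC(1)] abs_clip_le[OF AC(2)] by (simp add: F_def abs_le_iff minus_le_iff)
  ultimately have "continuous_on ({-A..A} \<times> {-C..C}) F" "F \<in> {-A..A} \<times> {-C..C} \<rightarrow> {-A..A} \<times> {-C..C}" by blast+
  moreover have "compact ({-A..A} \<times> {-C..C})" "convex ({-A..A} \<times> {-C..C})" "{-A..A} \<times> {-C..C} \<noteq> {}"
    using AC by (auto intro!: compact_Times convex_Times)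
  ultimately obtain v where v: "v \<in> {-A..A} \<times> {-C..C}" "F v = v"
    using brouwer by metis
  obtain a c where ac: "v = (a, c)" by force
  \<comment> \<open>One coordinate of the fixed point. In the interior nothing was clipped, so
    \<open>r = 0\<close>; at \<open>s = M\<close> the equation forces \<open>r \<le> 0\<close>, at
    \<open>s = - M\<close> it forces \<open>r \<ge> 0\<close>, and the sign condition gives the
    reverse inequality.\<close>
  have *: "r = 0" if "clip M (s - r) = s" "s = - M \<Longrightarrow> r \<le> 0" "s = M \<Longrightarrow> r \<ge> 0" "M \<ge> 0" for M r s
    using that by (auto simp: clip_def max_def min_def split: if_splits)
  show thesis
  proof
    show "\<bar>a\<bar> \<le> A" "\<bar>c\<bar> \<le> C" using v(1) by (auto simp: ac)
    then show "g (a, c) = 0" "h (a, c) = 0"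
      using v(2) g[of c] h[of a] AC *[of A a "g (a, c)"] *[of C c "h (a, c)"]
      by (auto simp: F_def ac)
  qed
qed

section \<open>An a priori bound\<close>

lemma DERIV_lower_bound:
  fixes f :: "real \<Rightarrow> real"
  assumes "0 \<le> t" and "\<And>s. \<lbrakk>0 \<le> s; s \<le> t\<rbrakk> \<Longrightarrow> (f has_real_derivative f' s) (at s) \<and> f' s \<ge> m"
  shows "f t \<ge> f 0 + m * t"
proof -
  have "f 0 - m * 0 \<le> f t - m * t"
  proof (rule DERIV_nonneg_imp_nondecreasing[OF \<open>0 \<le> t\<close>])
    fix s assume "0 \<le> s" "s \<le> t"
    with assms(2) show "\<exists>y. ((\<lambda>s. f s - m * s) has_real_derivative y) (at s) \<and> 0 \<le> y"
      by (intro exI[of _ "f' s - m"]) (auto intro!: derivative_eq_intros)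
  qed
  then show ?thesis by simp
qed

lemma DERIV_upper_bound:
  fixes f :: "real \<Rightarrow> real"
  assumes "0 \<le> t" and "\<And>s. \<lbrakk>0 \<le> s; s \<le> t\<rbrakk> \<Longrightarrow> (f has_real_derivative f' s) (at s) \<and> f' s \<le> m"
  shows "f t \<le> f 0 + m * t"
proof -
  have "- f t \<ge> - f 0 + - m * t"
    using assms by (intro DERIV_lower_bound[where f' = "\<lambda>s. - f' s"]) (auto intro!: DERIV_minus)
  then show ?thesis by simp
qed

text \<open>Comparison with \<open>t (T - t)\<close>, whose second derivative is \<open>-2\<close>: the difference has a positive
  second derivative wherever it is positive, so it has no positive maximum.\<close>

lemma maximum_principle:
  fixes x v g :: "real \<Rightarrow> real"
  assumes x: "\<And>t. \<lbrakk>0 \<le> t; t \<le> T\<rbrakk> \<Longrightarrow> (x has_real_derivative v t) (at t)"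
    and v: "\<And>t. \<lbrakk>0 \<le> t; t \<le> T\<rbrakk> \<Longrightarrow> (v has_real_derivative g t) (at t)"
    and g: "\<And>t. \<lbrakk>0 \<le> t; t \<le> T; x t > 0\<rbrakk> \<Longrightarrow> g t \<ge> -1"
    and bc: "x 0 = 0" "x T = 0" and t: "0 \<le> t" "t \<le> T"
  shows "x t \<le> T\<^sup>2 / 4"
proof -
  define y where "y s = x s - s * (T - s)" for s
  define y' where "y' s = v s - T + 2 * s" for s
  have y: "(y has_real_derivative y' s) (at s)" if "0 \<le> s" "s \<le> T" for s
    unfolding y_def[abs_def] y'_def using x[OF that] by (auto intro!: derivative_eq_intros)
  have y': "(y' has_real_derivative g s + 2) (at s)" if "0 \<le> s" "s \<le> T" for s
    unfolding y'_def[abs_def] using v[OF that] by (auto intro!: derivative_eq_intros)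
  have "continuous_on {0..T} y"
    by (rule DERIV_continuous_on[of _ _ y']) (use y in \<open>auto intro: has_field_derivative_at_within\<close>)
  then obtain m where m: "m \<in> {0..T}" "\<And>s. s \<in> {0..T} \<Longrightarrow> y s \<le> y m"
    using continuous_attains_sup[of "{0..T}" y] t by auto
  have "y m \<le> 0"
  proof (rule ccontr)
    assume "\<not> y m \<le> 0"
    then have pos: "y m > 0" by simp
    have "m \<noteq> 0" "m \<noteq> T" using pos bc by (auto simp: y_def)
    with m have m': "0 < m" "m < T" by auto
    define d where "d = min m (T - m)"
    have d: "d > 0" using m' by (simp add: d_def)
    have y'm: "y' m = 0"
      by (rule DERIV_local_max[OF y d]) (use m m' in \<open>auto simp: d_def intro!: m(2)[simplified]\<close>)
    \<comment> \<open>Positivity of \<open>y m\<close> passes to \<open>x m\<close>, so the bound on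
      \<open>g\<close> applies and \<open>y'\<close> increases strictly through its zero at
      \<open>m\<close>. Just to the right of \<open>m\<close>, \<open>y\<close> then exceeds its
      maximum.\<close>
    have "m * (T - m) \<ge> 0" using m' by simp
    with pos have "x m > 0" unfolding y_def by linarith
    then have "g m + 2 > 0" using g[of m] m' by linarith
    then obtain e where e: "e > 0" "\<And>h. \<lbrakk>h > 0; h < e\<rbrakk> \<Longrightarrow> y' m < y' (m + h)"
      using DERIV_pos_inc_right[OF y'[of m]] m' by force
    \<comment> \<open>A point to the right of \<open>m\<close> that is both inside
      \<open>{0..T}\<close> and within the range \<open>e\<close> where \<open>y'\<close> is
      positive.\<close>
    define s where "s = m + min e (T - m) / 2"
    have s: "m < s" "s < T" "s < m + e" using e m' by (auto simp: s_def min_def field_simps)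
    have "y m < y s"
    proof (rule DERIV_pos_imp_increasing_open[OF s(1)])
      fix r assume r: "m < r" "r < s"
      have "y' r > 0" using e(2)[of "r - m"] r s y'm by simp
      then show "\<exists>z. (y has_real_derivative z) (at r) \<and> 0 < z" using y[of r] r s m' by auto
    next
      show "continuous_on {m..s} y"
        by (rule continuous_on_subset[OF \<open>continuous_on {0..T} y\<close>]) (use s m' in auto)
    qed
    moreover have "y s \<le> y m" using s m' by (intro m) auto
    ultimately show False by simp
  qed
  then have "x t \<le> t * (T - t)" using m(2)[of t] t by (simp add: y_def)
  also have "\<dots> \<le> T\<^sup>2 / 4"
    using zero_le_power2[of "T / 2 - t"] by (simp add: power2_eq_square algebra_simps)
  finally show ?thesis .
qed

section \<open>The clipped equations of motion\<close>

text \<open>The angular velocity in terms of its conjugate momentum. The momentum serves as the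
  state variable because its derivative \<open>- x * cos \<phi>\<close> contains no velocity, so
  truncating \<open>x\<close> alone bounds it.\<close>

definition ang_vel :: "real \<Rightarrow> real \<Rightarrow> real \<Rightarrow> real \<Rightarrow> real" where
  "ang_vel M P x p = clip P p / (1 + (clip M x)\<^sup>2)"

text \<open>Hamilton's equations of the system with \<open>x\<close>, \<open>u\<close> and
  \<open>p\<close> truncated. The angle enters only through sine and cosine, which are already
  bounded and Lipschitz.\<close>

definition clipped_field ::
    "real \<Rightarrow> real \<Rightarrow> real \<Rightarrow> real \<times> real \<times> real \<times> real \<Rightarrow> real \<times> real \<times> real \<times> real" where
  "clipped_field M U P = (\<lambda>(x, \<phi>, u, p).
    (clip U u, ang_vel M P x p, clip M x * (ang_vel M P x p)\<^sup>2 - sin \<phi>, - (clip M x * cos \<phi>)))"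

text \<open>The angle is not clipped, so that the
  translation by \<open>2 \<pi> k\<close> remains a symmetry.\<close>

definition clipped_solution ::
    "real \<Rightarrow> real \<Rightarrow> real \<Rightarrow> (real \<Rightarrow> real) \<Rightarrow> (real \<Rightarrow> real) \<Rightarrow> (real \<Rightarrow> real) \<Rightarrow> (real \<Rightarrow> real) \<Rightarrow> bool"
  where "clipped_solution M U P x \<phi> u p \<longleftrightarrow> (\<forall>t.
    (x has_real_derivative clip U (u t)) (at t) \<and>
    (\<phi> has_real_derivative ang_vel M P (x t) (p t)) (at t) \<and>
    (u has_real_derivative clip M (x t) * (ang_vel M P (x t) (p t))\<^sup>2 - sin (\<phi> t)) (at t) \<and>
    (p has_real_derivative - (clip M (x t) * cos (\<phi> t))) (at t))"

lemma has_vector_derivative_Pair_iff: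
  "((\<lambda>t. (f t, g t)) has_vector_derivative (a, b)) (at x) \<longleftrightarrow>
    (f has_vector_derivative a) (at x) \<and> (g has_vector_derivative b) (at x)"
  using bounded_linear.has_vector_derivative[OF bounded_linear_fst, of "\<lambda>t. (f t, g t)" "(a, b)" "at x"]
    bounded_linear.has_vector_derivative[OF bounded_linear_snd, of "\<lambda>t. (f t, g t)" "(a, b)" "at x"]
  by (auto intro: has_vector_derivative_Pair)

lemma clipped_solution_iff:
  "clipped_solution M U P x \<phi> u p \<longleftrightarrow>
    (\<forall>t. ((\<lambda>t. (x t, \<phi> t, u t, p t)) has_vector_derivative
      clipped_field M U P (x t, \<phi> t, u t, p t)) (at t))"
  unfolding clipped_solution_def clipped_field_def
  by (simp add: has_vector_derivative_Pair_iff has_real_derivative_iff_has_vector_derivative)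

lemma lipschitz_projections:
  "1-lipschitz_on UNIV (\<lambda>z :: real \<times> real \<times> real \<times> real. fst z)"
  "1-lipschitz_on UNIV (\<lambda>z :: real \<times> real \<times> real \<times> real. fst (snd z))"
  "1-lipschitz_on UNIV (\<lambda>z :: real \<times> real \<times> real \<times> real. fst (snd (snd z)))"
  "1-lipschitz_on UNIV (\<lambda>z :: real \<times> real \<times> real \<times> real. snd (snd (snd z)))"
  unfolding lipschitz_on_def mult_1
  by (intro conjI zero_le_one ballI dist_fst_le
      order_trans[OF dist_fst_le dist_snd_le] order_trans[OF dist_fst_le order_trans[OF dist_snd_le dist_snd_le]]
      order_trans[OF dist_snd_le order_trans[OF dist_snd_le dist_snd_le]])+

lemma clipped_field_lipschitz:
  assumes "M \<ge> 0" "U \<ge> 0" "P \<ge> 0"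
  obtains L B where "L-lipschitz_on UNIV (clipped_field M U P)" "\<And>z. norm (clipped_field M U P z) \<le> B"
proof -
  note clips = assms[THEN bounded_lipschitz_clip]
  note x = bounded_lipschitz_compose[OF clips(1) lipschitz_projections(1)]
  note u = bounded_lipschitz_compose[OF clips(2) lipschitz_projections(3)]
  note p = bounded_lipschitz_compose[OF clips(3) lipschitz_projections(4)]
  note sin\<phi> = bounded_lipschitz_compose[OF bounded_lipschitz_sin lipschitz_projections(2)]
  note cos\<phi> = bounded_lipschitz_compose[OF bounded_lipschitz_cos lipschitz_projections(2)]
  have v: "bounded_lipschitz (\<lambda>z :: real \<times> real \<times> real \<times> real. ang_vel M P (fst z) (snd (snd (snd z))))"
    using bounded_lipschitz_mult[OF p bounded_lipschitz_inverse[OF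
      bounded_lipschitz_add[OF bounded_lipschitz_const bounded_lipschitz_mult[OF x x]], of 1]]
    by (simp add: ang_vel_def power2_eq_square)
  note u' = bounded_lipschitz_diff[OF bounded_lipschitz_mult[OF x bounded_lipschitz_mult[OF v v]] sin\<phi>]
  note p' = bounded_lipschitz_uminus[OF bounded_lipschitz_mult[OF x cos\<phi>]]
  have "bounded_lipschitz (clipped_field M U P)"
    using bounded_lipschitz_Pair[OF u bounded_lipschitz_Pair[OF v bounded_lipschitz_Pair[OF u' p']]]
    by (simp add: clipped_field_def case_prod_unfold power2_eq_square)
  then show thesis using that by (metis bounded_lipschitzE)
qed

text \<open>The initial position is frozen at the origin; the initial momenta \<open>a\<close> and
  \<open>c\<close> are the shooting parameters, on which the endpoint must depend
  continuously.\<close>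

lemma clipped_flow:
  assumes "M \<ge> 0" "U \<ge> 0" "P \<ge> 0"
  obtains x \<phi> u p :: "real \<Rightarrow> real \<Rightarrow> real \<Rightarrow> real" where
    "\<And>a c. clipped_solution M U P (x a c) (\<phi> a c) (u a c) (p a c)"
    "\<And>a c. x a c 0 = 0" "\<And>a c. \<phi> a c 0 = 0" "\<And>a c. u a c 0 = a" "\<And>a c. p a c 0 = c"
    "\<And>t. continuous_on UNIV (\<lambda>(a, c). x a c t)" "\<And>t. continuous_on UNIV (\<lambda>(a, c). \<phi> a c t)"
proof -
  obtain L B where "L-lipschitz_on UNIV (clipped_field M U P)" "\<And>z. norm (clipped_field M U P z) \<le> B"
    using clipped_field_lipschitz[OF assms] by metis
  then obtain Z where Z: "continuous_on UNIV (\<lambda>(r, t). Z r t)" "\<And>r. Z r 0 = r"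
      "\<And>r t. (Z r has_vector_derivative clipped_field M U P (Z r t)) (at t)"
    using lipschitz_bounded_flow by metis
  have cont: "continuous_on UNIV (\<lambda>v. Z (0, 0, fst v, snd v) t)" for t
  proof -
    have "continuous_on UNIV (\<lambda>v. (\<lambda>(r, t). Z r t) ((0, 0, fst v, snd v), t))"
      by (rule continuous_on_compose2[OF Z(1)]) (auto intro!: continuous_intros)
    then show ?thesis by simp
  qed
  show thesis
  proof (rule that)
    show "clipped_solution M U P (\<lambda>t. fst (Z (0, 0, a, c) t)) (\<lambda>t. fst (snd (Z (0, 0, a, c) t)))
        (\<lambda>t. fst (snd (snd (Z (0, 0, a, c) t)))) (\<lambda>t. snd (snd (snd (Z (0, 0, a, c) t))))" for a c
      using Z(3) by (simp add: clipped_solution_iff)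
    show "continuous_on UNIV (\<lambda>(a, c). fst (Z (0, 0, a, c) t))"
      "continuous_on UNIV (\<lambda>(a, c). fst (snd (Z (0, 0, a, c) t)))" for t
      unfolding case_prod_unfold by (intro continuous_intros cont)+
  qed (simp_all add: Z(2))
qed

lemma clipped_solution_unique:
  assumes MUP: "M \<ge> 0" "U \<ge> 0" "P \<ge> 0"
    and z: "clipped_solution M U P x \<phi> u p" and w: "clipped_solution M U P x' \<phi>' u' p'"
    and eq: "x s = x' s" "\<phi> s = \<phi>' s" "u s = u' s" "p s = p' s"
  shows "x t = x' t" "\<phi> t = \<phi>' t" "u t = u' t" "p t = p' t"
proof -
  obtain L where L: "L-lipschitz_on UNIV (clipped_field M U P)"
    using clipped_field_lipschitz[OF MUP] by metis
  have "(x t, \<phi> t, u t, p t) = (x' t, \<phi>' t, u' t, p' t)"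
    by (rule lipschitz_ode_unique[where ?t0.0 = s, OF L z[unfolded clipped_solution_iff, THEN spec]
          w[unfolded clipped_solution_iff, THEN spec]]) (simp add: eq)
  then show "x t = x' t" "\<phi> t = \<phi>' t" "u t = u' t" "p t = p' t" by simp_all
qed

text \<open>Reversing time about \<open>s\<close> and reflecting the position in its value at
  \<open>s\<close> leaves \<open>u\<close> and \<open>p\<close> unsigned. The result is again a
  solution because \<open>clip\<close> is odd and, \<open>\<phi> s\<close> being a multiple of
  \<open>pi\<close>, sine changes sign while cosine does not.\<close>

lemma clipped_solution_reflect:
  assumes MUP: "M \<ge> 0" "U \<ge> 0" "P \<ge> 0"
    and z: "clipped_solution M U P x \<phi> u p" and s: "x s = 0" "\<phi> s = pi * of_int k"
  shows "x (2 * s - t) = - x t" "\<phi> (2 * s - t) = 2 * \<phi> s - \<phi> t" "u (2 * s - t) = u t" "p (2 * s - t) = p t"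
proof -
  have trig: "sin (2 * \<phi> s - y) = - sin y" "cos (2 * \<phi> s - y) = cos y" for y
    using sin_int_2pin[of k] cos_int_2pin[of k] by (simp_all add: s(2) sin_diff cos_diff mult_ac)
  have chain: "((\<lambda>t. f (2 * s - t)) has_real_derivative - D) (at t)"
    if "(f has_real_derivative D) (at (2 * s - t))" for f D t
    
  proof -
    have "((\<lambda>t. 2 * s - t) has_real_derivative -1) (at t)" by (auto intro!: derivative_eq_intros)
    from DERIV_chain2[OF _ this, OF that] show ?thesis by simp
  qed
  have "clipped_solution M U P (\<lambda>t. - x (2 * s - t)) (\<lambda>t. 2 * \<phi> s - \<phi> (2 * s - t))
      (\<lambda>t. u (2 * s - t)) (\<lambda>t. p (2 * s - t))"
    unfolding clipped_solution_def
  proof (intro allI conjI)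
    fix t
    note d = z[unfolded clipped_solution_def, THEN spec, of "2 * s - t"]
    show "((\<lambda>t. - x (2 * s - t)) has_real_derivative clip U (u (2 * s - t))) (at t)"
      using DERIV_minus[OF chain[OF d[THEN conjunct1]]] by simp
    show "((\<lambda>t. 2 * \<phi> s - \<phi> (2 * s - t)) has_real_derivative
        ang_vel M P (- x (2 * s - t)) (p (2 * s - t))) (at t)"
      using DERIV_diff[OF DERIV_const chain[OF d[THEN conjunct2, THEN conjunct1]], of "2 * \<phi> s"] MUP
      by (simp add: ang_vel_def)
    show "((\<lambda>t. u (2 * s - t)) has_real_derivative clip M (- x (2 * s - t)) *
        (ang_vel M P (- x (2 * s - t)) (p (2 * s - t)))\<^sup>2 - sin (2 * \<phi> s - \<phi> (2 * s - t))) (at t)"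
      using chain[OF d[THEN conjunct2, THEN conjunct2, THEN conjunct1]] MUP
      by (simp add: ang_vel_def trig)
    show "((\<lambda>t. p (2 * s - t)) has_real_derivative
        - (clip M (- x (2 * s - t)) * cos (2 * \<phi> s - \<phi> (2 * s - t)))) (at t)"
      using chain[OF d[THEN conjunct2, THEN conjunct2, THEN conjunct2]] MUP by (simp add: trig)
  qed
  \<comment> \<open>Both solutions have the same state at time \<open>s\<close>, the fixed point of
    the time reversal; for the first coordinate this uses \<open>x s = 0\<close>.\<close>
  note uniq = clipped_solution_unique[OF MUP z this, of s t]
  from uniq(1,2) show "x (2 * s - t) = - x t" "\<phi> (2 * s - t) = 2 * \<phi> s - \<phi> t"
    using s(1) by (simp_all add: algebra_simps)
  from uniq(3,4) show "u (2 * s - t) = u t" "p (2 * s - t) = p t"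
    using s(1) by simp_all
qed

lemma abs_ang_vel_le:
  assumes "P \<ge> 0"
  shows "\<bar>ang_vel M P x p\<bar> \<le> P"
proof -
  have "\<bar>clip P p\<bar> / (1 + (clip M x)\<^sup>2) \<le> P / 1"
    by (intro frac_le abs_clip_le) (use assms in auto)
  then show ?thesis by (simp add: ang_vel_def)
qed

section \<open>Shooting\<close>

lemma clipped_boundary_value_problem:
  assumes T: "T > 0" and N: "N \<ge> 0"
  obtains M U P x \<phi> u p where "M \<ge> 0" "U \<ge> 0" "P \<ge> 0" "clipped_solution M U P x \<phi> u p"
    "x 0 = 0" "\<phi> 0 = 0" "x T = 0" "\<phi> T = N"
    "\<And>t. \<lbrakk>0 \<le> t; t \<le> T\<rbrakk> \<Longrightarrow> \<bar>x t\<bar> \<le> M \<and> \<bar>u t\<bar> \<le> U \<and> \<bar>p t\<bar> \<le> P"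
proof -
  \<comment> \<open>The constants are chosen one after another. \<open>M\<close> comes from the
    maximum principle and bounds the force on \<open>p\<close>. Momentum at least \<open>c0\<close>
    gives angular velocity at least \<open>N / T\<close>, and starting from \<open>C\<close> it
    stays above \<open>c0\<close>. \<open>P\<close> covers all values of \<open>p\<close>; then
    \<open>D\<close> bounds the force on \<open>u\<close>, \<open>A\<close> the change of
    \<open>u\<close>, and \<open>U\<close> all its values.\<close>
  define M where "M = T\<^sup>2 / 4"
  define c0 where "c0 = N / T * (1 + M\<^sup>2)"
  define C where "C = c0 + M * T"
  define P where "P = C + M * T"
  define D where "D = M * P\<^sup>2 + 1"
  define A where "A = D * T"
  define U where "U = A + D * T"
  have M: "M \<ge> 0" by (simp add: M_def)
  have c0: "c0 \<ge> 0" using N T by (simp add: c0_def)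
  have MT: "M * T \<ge> 0" using M T by simp
  have C: "C \<ge> 0" and P: "P \<ge> 0" using c0 MT by (simp_all add: C_def P_def)
  have D: "D \<ge> 0" using M by (simp add: D_def)
  have A: "A \<ge> 0" and U: "U \<ge> 0" using D T by (simp_all add: A_def U_def)
  obtain x \<phi> u p :: "real \<Rightarrow> real \<Rightarrow> real \<Rightarrow> real" where
    sol: "\<And>a c. clipped_solution M U P (x a c) (\<phi> a c) (u a c) (p a c)"
    and init: "\<And>a c. x a c 0 = 0" "\<And>a c. \<phi> a c 0 = 0" "\<And>a c. u a c 0 = a" "\<And>a c. p a c 0 = c"
    and cont: "\<And>t. continuous_on UNIV (\<lambda>(a, c). x a c t)" "\<And>t. continuous_on UNIV (\<lambda>(a, c). \<phi> a c t)"
    by (rule clipped_flow[OF M U P]) (rule that)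
  have dx: "(x a c has_real_derivative clip U (u a c t)) (at t)"
    and d\<phi>: "(\<phi> a c has_real_derivative ang_vel M P (x a c t) (p a c t)) (at t)"
    and du: "(u a c has_real_derivative
        clip M (x a c t) * (ang_vel M P (x a c t) (p a c t))\<^sup>2 - sin (\<phi> a c t)) (at t)"
    and dp: "(p a c has_real_derivative - (clip M (x a c t) * cos (\<phi> a c t))) (at t)" for a c t
    using sol[unfolded clipped_solution_def] by blast+
  have p'_le: "- M \<le> - (clip M y * cos z)" "- (clip M y * cos z) \<le> M" for y z
  proof -
    have "\<bar>clip M y * cos z\<bar> \<le> M"
      using mult_mono[OF abs_clip_le[OF M, of y] abs_cos_le_one[of z]] M by (simp add: abs_mult)
    then show "- M \<le> - (clip M y * cos z)" "- (clip M y * cos z) \<le> M" by linarith+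
  qed
  have u'_le: "- D \<le> clip M y * (ang_vel M P y q)\<^sup>2 - sin z"
    "clip M y * (ang_vel M P y q)\<^sup>2 - sin z \<le> D" for y q z
  proof -
    have "(ang_vel M P y q)\<^sup>2 \<le> P\<^sup>2"
      using abs_ang_vel_le[OF P] P by (simp add: abs_le_square_iff[symmetric])
    then have "\<bar>clip M y * (ang_vel M P y q)\<^sup>2\<bar> \<le> M * P\<^sup>2"
      using abs_clip_le[OF M] M by (simp add: abs_mult mult_mono)
    then show "- D \<le> clip M y * (ang_vel M P y q)\<^sup>2 - sin z"
      "clip M y * (ang_vel M P y q)\<^sup>2 - sin z \<le> D"
      using abs_sin_le_one[of z] unfolding D_def by linarith+
  qed
  have p: "c - M * T \<le> p a c t" "p a c t \<le> c + M * T" and u: "a - A \<le> u a c t" "u a c t \<le> a + A"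
    if t: "0 \<le> t" "t \<le> T" for a c t
  proof -
    have "p a c t \<ge> p a c 0 + - M * t" "p a c t \<le> p a c 0 + M * t"
      by (rule DERIV_lower_bound[OF t(1) conjI[OF dp p'_le(1)]])
        (rule DERIV_upper_bound[OF t(1) conjI[OF dp p'_le(2)]])
    moreover have "M * t \<le> M * T" using t M by (simp add: mult_left_mono)
    ultimately show "c - M * T \<le> p a c t" "p a c t \<le> c + M * T" unfolding init by linarith+
    have "u a c t \<ge> u a c 0 + - D * t" "u a c t \<le> u a c 0 + D * t"
      by (rule DERIV_lower_bound[OF t(1) conjI[OF du u'_le(1)]])
        (rule DERIV_upper_bound[OF t(1) conjI[OF du u'_le(2)]])
    moreover have "D * t \<le> A" using t D by (simp add: A_def mult_left_mono)
    ultimately show "a - A \<le> u a c t" "u a c t \<le> a + A" unfolding init by linarith+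
  qed
  \<comment> \<open>Starting from \<open>A\<close>, \<open>u\<close> cannot become negative before
    time \<open>T\<close>, so \<open>x\<close> is nondecreasing; the start \<open>- A\<close> is
    symmetric.\<close>
  have x_hi: "x A c T \<ge> 0" for c
    using DERIV_lower_bound[of T "x A c" "\<lambda>t. clip U (u A c t)" 0] dx u[of _ A c] T clip_nonneg[OF U]
    by (simp add: init)
  have x_lo: "x (- A) c T \<le> 0" for c
    using DERIV_upper_bound[of T "x (- A) c" "\<lambda>t. clip U (u (- A) c t)" 0] dx u[of _ "- A" c] T
      clip_nonpos[OF U]
    by (simp add: init)
  \<comment> \<open>From \<open>- C\<close> the momentum stays nonpositive, so the angle never rises
    above 0.\<close>
  have \<phi>_lo: "\<phi> a (- C) T \<le> N" for a
  proof -
    have "\<phi> a (- C) T \<le> \<phi> a (- C) 0 + 0 * T"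
    proof (rule DERIV_upper_bound)
      fix s assume "0 \<le> s" "s \<le> T"
      then have "p a (- C) s \<le> 0" using p(2)[of s a "- C"] c0 by (simp add: C_def)
      then have "ang_vel M P (x a (- C) s) (p a (- C) s) \<le> 0"
        unfolding ang_vel_def by (intro divide_nonpos_nonneg clip_nonpos P) auto
      then show "(\<phi> a (- C) has_real_derivative ang_vel M P (x a (- C) s) (p a (- C) s)) (at s) \<and>
          ang_vel M P (x a (- C) s) (p a (- C) s) \<le> 0" using d\<phi> by blast
    qed (use T in simp)
    then show ?thesis using N by (simp add: init)
  qed
  have \<phi>_hi: "\<phi> a C T \<ge> N" for a
  proof -
    have "\<phi> a C T \<ge> \<phi> a C 0 + N / T * T"
    proof (rule DERIV_lower_bound)
      fix s assume "0 \<le> s" "s \<le> T"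
      then have ps: "c0 \<le> p a C s" "p a C s \<le> P"
        using p(1)[of s C a] p(2)[of s a C] by (simp_all add: C_def P_def)
      have "(clip M (x a C s))\<^sup>2 \<le> M\<^sup>2"
        using abs_clip_le[OF M] M by (simp add: abs_le_square_iff[symmetric])
      then have "c0 / (1 + M\<^sup>2) \<le> p a C s / (1 + (clip M (x a C s))\<^sup>2)"
        using ps c0 by (intro frac_le) (auto simp: add_pos_nonneg)
      moreover have "c0 / (1 + M\<^sup>2) = N / T"
        using sum_power2_gt_zero_iff[of 1 M] by (simp add: c0_def)
      moreover have "clip P (p a C s) = p a C s" using ps c0 by (intro clip_id) auto
      ultimately have "ang_vel M P (x a C s) (p a C s) \<ge> N / T" by (simp add: ang_vel_def)
      then show "(\<phi> a C has_real_derivative ang_vel M P (x a C s) (p a C s)) (at s) \<and>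
          N / T \<le> ang_vel M P (x a C s) (p a C s)" using d\<phi> by blast
    qed (use T in simp)
    then show ?thesis using T by (simp add: init)
  qed
  \<comment> \<open>The velocity parameter \<open>a\<close> controls the sign of \<open>x\<close> at
    \<open>T\<close>, and \<open>c\<close> that of the angle minus \<open>N\<close>.\<close>
  obtain a c where ac: "\<bar>a\<bar> \<le> A" "\<bar>c\<bar> \<le> C" and xT: "x a c T = 0" and \<phi>T: "\<phi> a c T = N"
    by (rule poincare_miranda_2[OF A C cont(1)[of T] continuous_on_diff[OF cont(2)[of T] continuous_on_const[of _ N]]])
      (use x_hi x_lo \<phi>_hi \<phi>_lo in auto)
  have u_le: "\<bar>u a c t\<bar> \<le> U" and p_le: "\<bar>p a c t\<bar> \<le> P" if t: "0 \<le> t" "t \<le> T" for t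
    using u[OF t, of a c] p(1)[OF t, of c a] p(2)[OF t, of a c] ac by (auto simp: U_def A_def P_def abs_le_iff)
  have dx': "(x a c has_real_derivative u a c t) (at t)" if "0 \<le> t" "t \<le> T" for t
    using dx[of a c t] clip_id[OF u_le[OF that]] by simp
  \<comment> \<open>The truncation of \<open>x\<close> may still be active here. Only the sign of
    \<open>clip M\<close>, which agrees with that of \<open>x\<close>, enters the one-sided bounds
    on the second derivative.\<close>
  have x_le: "\<bar>x a c t\<bar> \<le> M" if t: "0 \<le> t" "t \<le> T" for t
  proof -
    have "x a c t \<le> M" unfolding M_def
    proof (rule maximum_principle[OF dx' du _ init(1) xT t])
      fix s assume "0 < x a c s"
      then have "clip M (x a c s) * (ang_vel M P (x a c s) (p a c s))\<^sup>2 \<ge> 0"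
        using clip_nonneg[OF M] by simp
      then show "-1 \<le> clip M (x a c s) * (ang_vel M P (x a c s) (p a c s))\<^sup>2 - sin (\<phi> a c s)"
        using sin_le_one[of "\<phi> a c s"] by linarith
    qed
    moreover have "- x a c t \<le> M" unfolding M_def
    proof (rule maximum_principle[OF DERIV_minus[OF dx'] DERIV_minus[OF du] _ _ _ t])
      fix s assume "0 < - x a c s"
      then have "clip M (x a c s) * (ang_vel M P (x a c s) (p a c s))\<^sup>2 \<le> 0"
        using clip_nonpos[OF M] by (simp add: mult_nonpos_nonneg)
      then show "-1 \<le> - (clip M (x a c s) * (ang_vel M P (x a c s) (p a c s))\<^sup>2 - sin (\<phi> a c s))"
        using sin_ge_minus_one[of "\<phi> a c s"] by linarith
    qed (simp_all add: init xT)
    ultimately show ?thesis by linarith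
  qed
  show thesis
    by (rule that[OF M U P sol[of a c]]) (use init xT \<phi>T x_le u_le p_le in auto)
qed

section \<open>The Lagrangian system\<close>

text \<open>The passage from Hamilton's to Lagrange's equations: \<open>u\<close> and
  \<open>p\<close> are the momenta conjugate to \<open>x\<close> and \<open>\<phi>\<close>. The
  explicit derivatives of \<open>u\<close> and of the angular velocity are continuous, which gives
  the required smoothness.\<close>

lemma lagrangian_solutionI:
  assumes x: "\<And>t. (x has_real_derivative u t) (at t)"
    and \<phi>: "\<And>t. (\<phi> has_real_derivative p t / (1 + (x t)\<^sup>2)) (at t)"
    and u: "\<And>t. (u has_real_derivative x t * (p t / (1 + (x t)\<^sup>2))\<^sup>2 - sin (\<phi> t)) (at t)"
    and p: "\<And>t. (p has_real_derivative - (x t * cos (\<phi> t))) (at t)"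
  shows "lagrangian_solution Lagr x \<phi>"
proof -
  define v where "v t = p t / (1 + (x t)\<^sup>2)" for t
  have pos: "1 + (x t)\<^sup>2 \<noteq> 0" for t using zero_le_power2[of "x t"] by linarith
  have dx: "deriv x = u" and d\<phi>: "deriv \<phi> = v"
    using x \<phi> by (auto simp: v_def intro!: DERIV_imp_deriv ext)
  have cont: "continuous_on UNIV x" "continuous_on UNIV \<phi>" "continuous_on UNIV u" "continuous_on UNIV p"
    using x \<phi> u p by (meson DERIV_isCont continuous_at_imp_continuous_on)+
  have contv: "continuous_on UNIV v"
    unfolding v_def[abs_def] by (intro continuous_intros cont) (use pos in blast)
  have v: "(v has_real_derivative
      (- (x t * cos (\<phi> t)) * (1 + (x t)\<^sup>2) - p t * (2 * x t * u t)) / (1 + (x t)\<^sup>2)\<^sup>2) (at t)" for t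
    unfolding v_def[abs_def]
    by (auto intro!: derivative_eq_intros x p simp: pos pos[unfolded power2_eq_square] power2_eq_square)
  have C1: "f C1_differentiable_on UNIV"
    if "\<And>t. (f has_real_derivative f' t) (at t)" "continuous_on UNIV f'" for f f'
    unfolding C1_differentiable_on_def has_real_derivative_iff_has_vector_derivative[symmetric]
    using that by blast
  have "continuous_on UNIV (\<lambda>t. x t * (p t / (1 + (x t)\<^sup>2))\<^sup>2 - sin (\<phi> t))"
    by (intro continuous_intros cont) (use pos in blast)
  then have "C2_on_reals x"
    unfolding C2_on_reals_def dx using C1[OF x] C1[OF u] cont by blast
  moreover have "continuous_on UNIV
      (\<lambda>t. (- (x t * cos (\<phi> t)) * (1 + (x t)\<^sup>2) - p t * (2 * x t * u t)) / (1 + (x t)\<^sup>2)\<^sup>2)"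
    by (intro continuous_intros cont) (use pos in simp)
  then have "C2_on_reals \<phi>"
    unfolding C2_on_reals_def d\<phi> using C1[OF \<phi>] C1[OF v] contv by (simp add: v_def[abs_def])
  moreover have "lagrange_equations Lagr x \<phi>"
  proof -
    have 1: "deriv (\<lambda>w. Lagr a b w d) c = c" "deriv (\<lambda>w. Lagr w b c d) a = a * d\<^sup>2 - sin b"
      "deriv (\<lambda>w. Lagr a b c w) d = (a\<^sup>2 + 1) * d" "deriv (\<lambda>w. Lagr a w c d) b = - (a * cos b)"
      for a b c d
      unfolding Lagr_def by (rule DERIV_imp_deriv, auto intro!: derivative_eq_intros)+
    have "((x t)\<^sup>2 + 1) * v t = p t" for t using pos[of t] by (simp add: v_def add.commute)
    then show ?thesis
      unfolding lagrange_equations_def dx d\<phi> 1 using u p by (simp add: v_def)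
  qed
  ultimately show ?thesis by (simp add: lagrangian_solution_def)
qed

theorem theorem1p1:
  fixes \<omega> :: real and k :: nat
  assumes "\<omega> > 0" and "k \<ge> 1"
  shows "\<exists>x \<phi> :: real \<Rightarrow> real.
    lagrangian_solution Lagr x \<phi> \<and>
    (\<forall>t. x t = - x (- t) \<and> \<phi> t = - \<phi> (- t)) \<and>
    (\<forall>t. x (t + \<omega>) = x t \<and> \<phi> (t + \<omega>) = \<phi> t + 2 * pi * real k)"
proof -
  define T where "T = \<omega> / 2"
  have T: "T > 0" using assms by (simp add: T_def)
  obtain M U P x \<phi> u p where MUP: "M \<ge> 0" "U \<ge> 0" "P \<ge> 0"
    and sol: "clipped_solution M U P x \<phi> u p"
    and bc: "x 0 = 0" "\<phi> 0 = 0" "x T = 0" "\<phi> T = pi * real k"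
    and bound: "\<And>t. \<lbrakk>0 \<le> t; t \<le> T\<rbrakk> \<Longrightarrow> \<bar>x t\<bar> \<le> M \<and> \<bar>u t\<bar> \<le> U \<and> \<bar>p t\<bar> \<le> P"
    by (rule clipped_boundary_value_problem[OF T, of "pi * real k"]) (simp, rule that)
  \<comment> \<open>Reflection at time 0 is the oddness; composed with reflection at
    \<open>T\<close> it gives translation by \<open>2 * T = \<omega>\<close>, with the angle
    advancing by \<open>2 * pi * k\<close>.\<close>
  note at0 = clipped_solution_reflect[OF MUP sol bc(1), of 0, simplified bc, simplified]
  note atT = clipped_solution_reflect[OF MUP sol bc(3), of "int k", simplified bc, simplified]
  have per: "x (t + \<omega>) = x t" "\<phi> (t + \<omega>) = \<phi> t + 2 * pi * real k" "u (t + \<omega>) = u t" "p (t + \<omega>) = p t" for t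
    using atT[of "- t"] at0[of t] by (simp_all add: T_def add.commute)
  \<comment> \<open>The bounds hold on half a period. Being an even and periodic condition, they
    extend to all times.\<close>
  define b where "b t \<longleftrightarrow> \<bar>x t\<bar> \<le> M \<and> \<bar>u t\<bar> \<le> U \<and> \<bar>p t\<bar> \<le> P" for t
  interpret b: periodic_fun_simple b \<omega>
    by standard (simp add: b_def per)
  have b: "b t" for t
  proof -
    have even: "b (- s) \<longleftrightarrow> b s" for s using at0[of s] by (simp add: b_def)
    \<comment> \<open>Rounding after the shift by \<open>T\<close> places the remainder
      \<open>s\<close> in the period centred at 0.\<close>
    define n where "n = \<lfloor>(t + T) / \<omega>\<rfloor>"
    define s where "s = t - of_int n * \<omega>"
    have "of_int n \<le> (t + T) / \<omega>" "(t + T) / \<omega> < of_int n + 1" unfolding n_def by linarith+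
    then have "of_int n * \<omega> \<le> t + T" "t + T < (of_int n + 1) * \<omega>"
      using assms(1) by (simp_all add: pos_le_divide_eq pos_divide_less_eq)
    then have "\<bar>s\<bar> \<le> T" unfolding s_def T_def abs_le_iff by (simp add: field_simps)
    then have "b \<bar>s\<bar>" using bound[of "\<bar>s\<bar>"] by (simp add: b_def)
    then have "b s" using even[of s] by (simp add: abs_if split: if_splits)
    then show "b t" using b.minus_of_int[of t n] by (simp add: s_def)
  qed
  have "lagrangian_solution Lagr x \<phi>"
  proof (rule lagrangian_solutionI)
    fix t
    have "clip M (x t) = x t" "clip U (u t) = u t" "clip P (p t) = p t"
      using b[of t] by (simp_all add: b_def clip_id)
    then show "(x has_real_derivative u t) (at t)"
      "(\<phi> has_real_derivative p t / (1 + (x t)\<^sup>2)) (at t)"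
      "(u has_real_derivative x t * (p t / (1 + (x t)\<^sup>2))\<^sup>2 - sin (\<phi> t)) (at t)"
      "(p has_real_derivative - (x t * cos (\<phi> t))) (at t)"
      using sol[unfolded clipped_solution_def, THEN spec, of t] by (simp_all add: ang_vel_def)
  qed
  moreover have "x t = - x (- t) \<and> \<phi> t = - \<phi> (- t)" for t using at0[of t] by simp
  ultimately show ?thesis using per by blast
qed

end
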